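(* Let $m\ge 1$, let $d_1,\dots,d_m$ be powers of $2$, and let $\rho=\rho_{1,2,\dots,m}$ and $\sigma=\sigma_{1,2,\dots,m}$ be states in $\mathcal{D}(\mathbb{C}^{d_1}\otimes\cdots\otimes\mathbb{C}^{d_m})$. Measure each party $i$ with the MUB measurement of dimension $d_i$, and let $p=p_{1,2,\dots,m}$ and $q=q_{1,2,\dots,m}$, probability distributions on $\times_{i=1}^m[d_i(d_i+1)]$, be the resulting outcome distributions for $\rho$ and $\sigma$ respectively. Then $$\|p-q\|_2=\frac{\sqrt{\sum_{S\subseteq[m]}\|\rho_S-\sigma_S\|_2^2}}{\prod_{i=1}^m(d_i+1)},$$ and for every $S\subseteq[m]$, $$\|p_S\|_2\le\frac{2^{|S|/2}}{\prod_{i\in S}(d_i+1)},\qquad \|q_S\|_2\le\frac{2^{|S|/2}}{\prod_{i\in S}(d_i+1)}.$$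
   Context: $\mathcal{D}(\cdot)$ denotes the set of density operators (positive semidefinite, trace one). $[m]=\{1,\dots,m\}$. For $S\subseteq[m]$, $\rho_S$ is the reduced density matrix of $\rho$ on the parties in $S$ (partial trace over the others), and $p_S$ is the marginal of $p$ on the coordinates in $S$; for $S=\emptyset$ these are the number $1$. For Hermitian $A$, $\|A\|_2=\sqrt{\operatorname{Tr}(A^2)}$; for real vectors $\|\cdot\|_2$ is the Euclidean norm. For $d$ a power of 2, there is a family of $d+1$ mutually unbiased bases (MUBs) of $\mathbb{C}^d$: orthonormal bases $\{|\beta_{i,j}\rangle\}_{j=1}^d$, $0\le i\le d$, with $|\langle\beta_{i,j}|\beta_{s,t}\rangle|^2=1/d$ whenever $i\ne s$. Such a family is obtained by partitioning the Pauli group $\{I,X,Y,Z\}^{\otimes k}$ ($d=2^k$) into $d+1$ commuting families of size $d$ that pairwise meet only in the identity, and taking the common eigenbasis of each. The MUB measurement of dimension $d$ is the POVM $\{\frac{1}{d+1}|\beta_{i,j}\rangle\langle\beta_{i,j}|:0\le i\le d,\ 1\le j\le d\}$ with $d(d+1)$ outcomes. Measuring each party means applying the tensor product POVM, whose elements are tensor products of elements of the local POVMs, so the probability of an outcome with element $M$ is $\operatorname{Tr}(M\rho)$. *)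

theory Defs
  imports "HOL-Analysis.Analysis"
begin

text \<open>
  Both the number of parties and their dimensions vary inside the statement, so dimensions cannot be
  types. For a finite index set \<open>B\<close>, a vector of \<open>\<complex>\<^sup>B\<close> is a function on \<open>B\<close> and an operator on
  \<open>\<complex>\<^sup>B\<close> is its matrix \<open>A x y\<close> in the standard basis, with \<open>x\<close> the row index; only values at
  indices in \<open>B\<close> are ever used.
\<close>

type_synonym 'i operator = "'i \<Rightarrow> 'i \<Rightarrow> complex"

definition op_mult :: "'i set \<Rightarrow> 'i operator \<Rightarrow> 'i operator \<Rightarrow> 'i operator" where
  "op_mult B A C = (\<lambda>x y. \<Sum>z\<in>B. A x z * C z y)"

definition op_diff :: "'i operator \<Rightarrow> 'i operator \<Rightarrow> 'i operator" where
  "op_diff A C = (\<lambda>x y. A x y - C x y)"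

definition op_trace :: "'i set \<Rightarrow> 'i operator \<Rightarrow> complex" where
  "op_trace B A = (\<Sum>x\<in>B. A x x)"

definition inner_on :: "'i set \<Rightarrow> ('i \<Rightarrow> complex) \<Rightarrow> ('i \<Rightarrow> complex) \<Rightarrow> complex" where
  "inner_on B u v = (\<Sum>x\<in>B. cnj (u x) * v x)"

definition hermitian_on :: "'i set \<Rightarrow> 'i operator \<Rightarrow> bool" where
  "hermitian_on B A \<longleftrightarrow> (\<forall>x\<in>B. \<forall>y\<in>B. A x y = cnj (A y x))"

text \<open>For Hermitian \<open>A\<close> the quadratic form below is real.\<close>

definition psd_on :: "'i set \<Rightarrow> 'i operator \<Rightarrow> bool" where
  "psd_on B A \<longleftrightarrow> hermitian_on B A \<and>
     (\<forall>v. 0 \<le> Re (inner_on B v (\<lambda>x. \<Sum>y\<in>B. A x y * v y)))"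

definition density_operator :: "'i set \<Rightarrow> 'i operator \<Rightarrow> bool" where
  "density_operator B A \<longleftrightarrow> psd_on B A \<and> op_trace B A = 1"

text \<open>Used for Hermitian \<open>A\<close> only, where the trace of \<open>A\<^sup>2\<close> is real and nonnegative.\<close>

definition op_norm2 :: "'i set \<Rightarrow> 'i operator \<Rightarrow> real" where
  "op_norm2 B A = sqrt (Re (op_trace B (op_mult B A A)))"

definition orthonormal_basis_on ::
    "'i set \<Rightarrow> 'j set \<Rightarrow> ('j \<Rightarrow> 'i \<Rightarrow> complex) \<Rightarrow> bool" where
  "orthonormal_basis_on B J b \<longleftrightarrow>
     (\<forall>j\<in>J. \<forall>l\<in>J. inner_on B (b j) (b l) = (if j = l then 1 else 0)) \<and>
     (\<forall>w. \<exists>c. \<forall>x\<in>B. w x = (\<Sum>j\<in>J. c j * b j x))"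

text \<open>\<open>\<beta> i j x\<close> is the \<open>x\<close>-th coordinate of the \<open>j\<close>-th vector of the \<open>i\<close>-th basis.\<close>

definition mub_family :: "nat \<Rightarrow> (nat \<Rightarrow> nat \<Rightarrow> nat \<Rightarrow> complex) \<Rightarrow> bool" where
  "mub_family d \<beta> \<longleftrightarrow>
     (\<forall>i\<in>{0..d}. orthonormal_basis_on {1..d} {1..d} (\<beta> i)) \<and>
     (\<forall>i\<in>{0..d}. \<forall>s\<in>{0..d}. i \<noteq> s \<longrightarrow>
        (\<forall>j\<in>{1..d}. \<forall>t\<in>{1..d}.
           (cmod (inner_on {1..d} (\<beta> i j) (\<beta> s t)))\<^sup>2 = 1 / real d))"

text \<open>
  The \<open>d (d + 1)\<close> outcomes of the MUB measurement are labelled by the pairs \<open>(i, j)\<close>.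
\<close>

definition mub_outcomes :: "nat \<Rightarrow> (nat \<times> nat) set" where
  "mub_outcomes d = {0..d} \<times> {1..d}"

definition mub_povm ::
    "nat \<Rightarrow> (nat \<Rightarrow> nat \<Rightarrow> nat \<Rightarrow> complex) \<Rightarrow> nat \<times> nat \<Rightarrow> nat operator" where
  "mub_povm d \<beta> = (\<lambda>(i, j) x y. \<beta> i j x * cnj (\<beta> i j y) / (of_nat d + 1))"

text \<open>
  The tensor product of the spaces \<open>\<complex>\<^bsup>d i\<^esup>\<close> for \<open>i \<in> S\<close> has the multi-indices in \<open>tensor_index d S\<close>
  as standard basis. For \<open>S = {}\<close> there is exactly one multi-index, so operators are scalars.
\<close>

definition tensor_index :: "(nat \<Rightarrow> nat) \<Rightarrow> nat set \<Rightarrow> (nat \<Rightarrow> nat) set" where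
  "tensor_index d S = (\<Pi>\<^sub>E i\<in>S. {1..d i})"

definition tensor_op :: "nat set \<Rightarrow> (nat \<Rightarrow> nat operator) \<Rightarrow> (nat \<Rightarrow> nat) operator" where
  "tensor_op S M = (\<lambda>x y. \<Prod>i\<in>S. M i (x i) (y i))"

definition partial_trace ::
    "nat \<Rightarrow> (nat \<Rightarrow> nat) \<Rightarrow> nat set \<Rightarrow> (nat \<Rightarrow> nat) operator \<Rightarrow> (nat \<Rightarrow> nat) operator" where
  "partial_trace m d S A = (\<lambda>x y. \<Sum>z\<in>tensor_index d ({1..m} - S).
     A (merge S ({1..m} - S) (x, z)) (merge S ({1..m} - S) (y, z)))"

definition joint_outcomes :: "(nat \<Rightarrow> nat) \<Rightarrow> nat set \<Rightarrow> (nat \<Rightarrow> nat \<times> nat) set" where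
  "joint_outcomes d S = (\<Pi>\<^sub>E i\<in>S. mub_outcomes (d i))"

text \<open>
  The trace of the product of the measurement operator and the state is real, so taking its real
  part only changes the type.
\<close>

definition outcome_dist ::
    "nat \<Rightarrow> (nat \<Rightarrow> nat) \<Rightarrow> (nat \<Rightarrow> nat \<Rightarrow> nat \<Rightarrow> nat \<Rightarrow> complex) \<Rightarrow> (nat \<Rightarrow> nat) operator \<Rightarrow>
     (nat \<Rightarrow> nat \<times> nat) \<Rightarrow> real" where
  "outcome_dist m d \<beta> \<rho> = (\<lambda>k.
     Re (op_trace (tensor_index d {1..m})
       (op_mult (tensor_index d {1..m})
         (tensor_op {1..m} (\<lambda>i. mub_povm (d i) (\<beta> i) (k i))) \<rho>)))"

definition marginal ::
    "nat \<Rightarrow> (nat \<Rightarrow> nat) \<Rightarrow> nat set \<Rightarrow> ((nat \<Rightarrow> nat \<times> nat) \<Rightarrow> real) \<Rightarrow>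
     (nat \<Rightarrow> nat \<times> nat) \<Rightarrow> real" where
  "marginal m d S p = (\<lambda>k. \<Sum>l\<in>joint_outcomes d ({1..m} - S).
     p (merge S ({1..m} - S) (k, l)))"

end

theory Submission
  imports Defs
begin

text \<open>
  A complete family of mutually unbiased bases is a complex projective 2-design: the squared
  Hilbert-Schmidt distance between \<open>\<Sum>\<^sub>k P\<^sub>k \<otimes> P\<^sub>k\<close> and \<open>I + SWAP\<close> is
  \<open>2d(d+1) - 4d(d+1) + 2d(d+1) = 0\<close>. For \<open>A\<close> on a tensor product,
  \<open>\<Sum>\<^sub>k (Tr M\<^sub>k A)\<^sup>2\<close> is therefore the trace of \<open>A \<otimes> A\<close> against \<open>\<Otimes>\<^sub>i (I + SWAP)\<^sub>i\<close>, up to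
  normalisation. Expanding this product over the set \<open>S\<close> of parties where the swap is chosen gives
  \<open>\<Sum>\<^sub>S Tr (A\<^sub>S\<^sup>2)\<close>. Taking \<open>A = \<rho> - \<sigma>\<close> gives the equality. For \<open>A = \<rho>\<^sub>S\<close>, whose outcome
  distribution is \<open>p\<^sub>S\<close>, it gives a sum of \<open>2\<^bsup>|S|\<^esup>\<close> purities, each at most 1.
\<close>

section \<open>Inner products of vectors and of their tensor products\<close>

lemma inner_on_diff:
  "inner_on B (\<lambda>x. u x - v x) (\<lambda>x. u x - v x) =
     inner_on B u u - inner_on B u v - inner_on B v u + inner_on B v v"
  by (simp add: inner_on_def algebra_simps sum.distrib sum_subtractf)

lemma inner_on_sum_left:
  "inner_on B (\<lambda>x. \<Sum>k\<in>K. w k x) v = (\<Sum>k\<in>K. inner_on B (w k) v)"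
  unfolding inner_on_def cnj_sum sum_distrib_right by (rule sum.swap)

lemma inner_on_sum_right:
  "inner_on B v (\<lambda>x. \<Sum>k\<in>K. w k x) = (\<Sum>k\<in>K. inner_on B v (w k))"
  unfolding inner_on_def sum_distrib_left by (rule sum.swap)

lemma inner_on_commute: "inner_on B u v = cnj (inner_on B v u)"
  by (simp add: inner_on_def mult.commute)

lemma inner_on_tensor:
  "inner_on (B \<times> C) (\<lambda>(x, y). u x * v y) (\<lambda>(x, y). u' x * v' y) =
     inner_on B u u' * inner_on C v v'"
  unfolding inner_on_def sum_product sum.cartesian_product
  by (rule sum.cong) (auto simp: algebra_simps)

lemma inner_on_cnj: "inner_on B (\<lambda>x. cnj (u x)) (\<lambda>x. cnj (v x)) = cnj (inner_on B u v)"
  by (simp add: inner_on_def)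

lemma inner_on_eq_0_imp:
  assumes "finite B" "inner_on B u u = 0" "x \<in> B"
  shows "u x = 0"
proof -
  have "complex_of_real (\<Sum>x\<in>B. (cmod (u x))\<^sup>2) = 0"
    using assms(2) unfolding inner_on_def
    by (simp add: complex_norm_square mult.commute del: of_real_power)
  then have "(\<Sum>x\<in>B. (cmod (u x))\<^sup>2) = 0"
    unfolding of_real_eq_0_iff .
  with assms(1,3) show ?thesis
    by (simp add: sum_nonneg_eq_0_iff)
qed

section \<open>The 2-design property of complete MUB families\<close>

text \<open>The entries of \<open>P_k \<otimes> P_k\<close> and of \<open>I + SWAP\<close> are
  viewed as vectors, and the squared norm of their difference is shown to vanish, so they agree
  entry by entry. The denominator collects one factor \<open>d + 1\<close> from each of the two POVM
  elements.\<close>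

lemma mub_two_design:
  assumes mub: "mub_family d \<beta>" and d: "d > 0"
    and X: "x \<in> {1..d}" "y \<in> {1..d}" "x' \<in> {1..d}" "y' \<in> {1..d}"
  shows "(\<Sum>k\<in>mub_outcomes d. mub_povm d \<beta> k x y * mub_povm d \<beta> k x' y') =
    (of_bool (x = y) * of_bool (x' = y') + of_bool (x = y') * of_bool (x' = y)) / (of_nat d + 1)\<^sup>2"
proof -
  define K where "K = mub_outcomes d"
  define B where "B = {1..d}"
  \<comment> \<open>A matrix on two copies has four indices. Grouping them by copy as
    \<open>((x, y), (x', y'))\<close> makes \<open>w k\<close> a tensor product on both levels, so
    \<open>inner_on_tensor\<close> applies twice and yields \<open>ww\<close>.\<close>
  define Q where "Q = (B \<times> B) \<times> (B \<times> B)"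
  define u where "u = (\<lambda>(i,j). \<beta> i j)"
  define g where "g = (\<lambda>k l. (cmod (inner_on B (u k) (u l)))\<^sup>2)"
  define w where
    "w k = (\<lambda>(a, b). (\<lambda>(x, y). u k x * cnj (u k y)) a * (\<lambda>(x, y). u k x * cnj (u k y)) b)" for k
  \<comment> \<open>\<open>w k\<close> holds the entries of \<open>P\<^sub>k \<otimes> P\<^sub>k\<close> and \<open>h\<close> those of \<open>I + SWAP\<close>\<close>
  define h :: "(nat \<times> nat) \<times> (nat \<times> nat) \<Rightarrow> complex" where
    "h = (\<lambda>((x, y), (x', y')). of_bool (x = y) * of_bool (x' = y') + of_bool (x = y') * of_bool (x' = y))"
  have fin: "finite B" "finite K" "finite Q"
    by (auto simp: B_def K_def Q_def mub_outcomes_def)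
  have card: "of_nat (card K) = (of_nat d * (of_nat d + 1) :: complex)" "card B = d"
    by (simp_all add: K_def B_def mub_outcomes_def card_cartesian_product algebra_simps)
  have same: "inner_on B (u (i, j)) (u (i, l)) = of_bool (j = l)"
    if "i \<in> {0..d}" "j \<in> {1..d}" "l \<in> {1..d}" for i j l
    using mub that by (auto simp: mub_family_def orthonormal_basis_on_def u_def B_def)
  have g: "g (i, j) (s, t) = (if i = s then of_bool (j = t) else 1 / real d)"
    if "i \<in> {0..d}" "j \<in> {1..d}" "s \<in> {0..d}" "t \<in> {1..d}" for i j s t
    using mub that same[of i j t] unfolding g_def
    by (auto simp: mub_family_def u_def B_def)
  have self: "inner_on B (u k) (u k) = 1" if "k \<in> K" for k
    using that same by (cases k) (auto simp: K_def mub_outcomes_def)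
  have ww: "inner_on Q (w k) (w l) = of_real ((g k l)\<^sup>2)" for k l
    unfolding w_def Q_def inner_on_tensor inner_on_cnj g_def
    by (simp add: complex_norm_square[symmetric] power2_eq_square)
  \<comment> \<open>The basis of \<open>k\<close> itself contributes 1. Each of the \<open>d\<close>
    other bases contributes \<open>d\<close> terms \<open>1 / d^2\<close>, so together they
    contribute 1 as well.\<close>
  have row: "(\<Sum>l\<in>K. (g k l)\<^sup>2) = 2" if "k \<in> K" for k
  proof -
    obtain i j where ij: "k = (i, j)"
      by (cases k)
    with that have k: "k = (i, j)" "i \<in> {0..d}" "j \<in> {1..d}"
      by (auto simp: K_def mub_outcomes_def)
    have "(\<Sum>l\<in>K. (g k l)\<^sup>2) = (\<Sum>s\<in>{0..d}. \<Sum>t\<in>{1..d}. (g k (s, t))\<^sup>2)"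
      unfolding K_def mub_outcomes_def sum.cartesian_product by simp
    also have "\<dots> = (\<Sum>s\<in>{0..d}. if s = i then 1 else 1 / real d)"
    proof (rule sum.cong[OF refl])
      fix s assume s: "s \<in> {0..d}"
      have "(\<Sum>t\<in>{1..d}. (g k (s, t))\<^sup>2) = (\<Sum>t\<in>{1..d}. if s = i then of_bool (t = j) else 1 / (real d)\<^sup>2)"
        by (rule sum.cong) (use k s g in \<open>auto simp: power_divide\<close>)
      also have "\<dots> = (if s = i then 1 else 1 / real d)"
        using k d by (simp add: power2_eq_square sum.delta of_bool_def)
      finally show "(\<Sum>t\<in>{1..d}. (g k (s, t))\<^sup>2) = (if s = i then 1 else 1 / real d)" .
    qed
    also have "\<dots> = 1 + (\<Sum>s\<in>{0..d} - {i}. 1 / real d)"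
      using k by (subst sum.remove[of _ i]) (auto intro!: sum.cong)
    also have "\<dots> = 2"
      using k d by simp
    finally show ?thesis .
  qed
  have h_cnj: "cnj (h z) = h z" for z
    by (simp add: h_def split: prod.split)
  \<comment> \<open>Pairing with \<open>h\<close> is a contraction: the identity sets
    \<open>y = x\<close> and \<open>y' = x'\<close>, the swap sets \<open>y = x'\<close> and
    \<open>y' = x\<close>.\<close>
  have h_sum: "(\<Sum>z\<in>Q. h z * f z) =
      (\<Sum>x\<in>B. \<Sum>x'\<in>B. f ((x, x), (x', x'))) + (\<Sum>x\<in>B. \<Sum>x'\<in>B. f ((x, x'), (x', x)))" for f
  proof -
    have "(\<Sum>z\<in>Q. h z * f z) = (\<Sum>x\<in>B. \<Sum>y\<in>B. \<Sum>x'\<in>B. \<Sum>y'\<in>B. h ((x, y), (x', y')) * f ((x, y), (x', y')))"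
      unfolding Q_def by (simp only: sum.cartesian_product')
    also have "\<dots> = (\<Sum>x\<in>B. \<Sum>y\<in>B. \<Sum>x'\<in>B. \<Sum>y'\<in>B.
          of_bool (x = y) * of_bool (x' = y') * f ((x, y), (x', y'))) +
        (\<Sum>x\<in>B. \<Sum>y\<in>B. \<Sum>x'\<in>B. \<Sum>y'\<in>B.
          of_bool (x' = y) * of_bool (x = y') * f ((x, y), (x', y')))"
      by (simp add: h_def algebra_simps sum.distrib)
    also have "(\<Sum>x\<in>B. \<Sum>y\<in>B. \<Sum>x'\<in>B. \<Sum>y'\<in>B.
          of_bool (x = y) * of_bool (x' = y') * f ((x, y), (x', y'))) =
        (\<Sum>x\<in>B. \<Sum>x'\<in>B. f ((x, x), (x', x')))"
      unfolding mult.assoc sum_distrib_left[symmetric]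
      using fin by (simp add: of_bool_def mult_delta_left)
    also have "(\<Sum>x\<in>B. \<Sum>y\<in>B. \<Sum>x'\<in>B. \<Sum>y'\<in>B.
          of_bool (x' = y) * of_bool (x = y') * f ((x, y), (x', y'))) =
        (\<Sum>x\<in>B. \<Sum>x'\<in>B. f ((x, x'), (x', x)))"
      unfolding mult.assoc sum_distrib_left[symmetric]
      using fin by (simp add: of_bool_def mult_delta_left)
    finally show ?thesis .
  qed
  \<comment> \<open>Both parts give 1: \<open>Tr (P \<otimes> P) = (Tr P)^2\<close> and
    \<open>Tr (SWAP (P \<otimes> P)) = Tr (P^2)\<close> for a rank-one projector
    \<open>P\<close>.\<close>
  have hw: "inner_on Q h (w k) = 2" if "k \<in> K" for k
  proof -
    have "inner_on Q h (w k) = (\<Sum>z\<in>Q. h z * w k z)"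
      unfolding inner_on_def h_cnj ..
    also have "\<dots> = (\<Sum>x\<in>B. \<Sum>x'\<in>B. (cnj (u k x) * u k x) * (cnj (u k x') * u k x')) +
       (\<Sum>x\<in>B. \<Sum>x'\<in>B. (cnj (u k x) * u k x) * (cnj (u k x') * u k x'))"
      unfolding h_sum by (simp add: w_def algebra_simps)
    also have "\<dots> = inner_on B (u k) (u k) * inner_on B (u k) (u k) +
        inner_on B (u k) (u k) * inner_on B (u k) (u k)"
      unfolding inner_on_def sum_product ..
    finally show ?thesis
      using self[OF that] by simp
  qed
  \<comment> \<open>\<open>Tr ((I + SWAP)^2) = 2 Tr I + 2 Tr SWAP = 2 d^2 + 2 d\<close>.\<close>
  have hh: "inner_on Q h h = 2 * (of_nat d * (of_nat d + 1))"
  proof -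
    have "inner_on Q h h = (\<Sum>z\<in>Q. h z * h z)"
      unfolding inner_on_def h_cnj ..
    also have "\<dots> = (\<Sum>x\<in>B. \<Sum>x'\<in>B. 1 + of_bool (x = x')) + (\<Sum>x\<in>B. \<Sum>x'\<in>B. of_bool (x = x') + 1)"
      unfolding h_sum by (intro arg_cong2[of _ _ _ _ "(+)"] sum.cong) (auto simp: h_def)
    also have "\<dots> = 2 * (of_nat d * (of_nat d + 1))"
      using fin card(2) by (simp add: sum.distrib of_bool_def algebra_simps)
    finally show ?thesis .
  qed
  have "inner_on Q (\<lambda>z. (\<Sum>k\<in>K. w k z) - h z) (\<lambda>z. (\<Sum>k\<in>K. w k z) - h z) =
      (\<Sum>k\<in>K. \<Sum>l\<in>K. of_real ((g k l)\<^sup>2)) - (\<Sum>k\<in>K. cnj (inner_on Q h (w k)))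
       - (\<Sum>k\<in>K. inner_on Q h (w k)) + inner_on Q h h"
    unfolding inner_on_diff inner_on_sum_left inner_on_sum_right ww
    by (simp only: inner_on_commute[of Q "w k" h for k])
  also have "\<dots> = (\<Sum>k\<in>K. of_real (\<Sum>l\<in>K. (g k l)\<^sup>2)) - (\<Sum>k\<in>K. 2)
       - (\<Sum>k\<in>K. 2) + 2 * (of_nat d * (of_nat d + 1))"
    by (simp add: hw hh)
  also have "\<dots> = (\<Sum>k\<in>K. 2) - (\<Sum>k\<in>K. 2)
       - (\<Sum>k\<in>K. 2) + 2 * (of_nat d * (of_nat d + 1))"
    by (simp only: row of_real_numeral cong: sum.cong)
  also have "\<dots> = 0"
    by (simp add: card)
  finally have "(\<Sum>k\<in>K. w k ((x, y), (x', y'))) = h ((x, y), (x', y'))"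
    using inner_on_eq_0_imp[of Q "\<lambda>z. (\<Sum>k\<in>K. w k z) - h z" "((x, y), (x', y'))"] fin X
    by (auto simp: Q_def B_def)
  moreover have "(\<Sum>k\<in>K. mub_povm d \<beta> k x y * mub_povm d \<beta> k x' y') =
      (\<Sum>k\<in>K. w k ((x, y), (x', y'))) / (of_nat d + 1)\<^sup>2"
    unfolding sum_divide_distrib
    by (rule sum.cong) (auto simp: w_def u_def mub_povm_def power2_eq_square)
  ultimately show ?thesis
    by (simp add: K_def h_def)
qed

lemma mub_povm_trace:
  assumes mub: "mub_family d \<beta>" and k: "k \<in> mub_outcomes d"
  shows "(\<Sum>x\<in>{1..d}. mub_povm d \<beta> k x x) = 1 / (of_nat d + 1)"
proof -
  obtain i j where ij: "k = (i, j)" "i \<in> {0..d}" "j \<in> {1..d}"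
    using k by (auto simp: mub_outcomes_def)
  have "inner_on {1..d} (\<beta> i j) (\<beta> i j) = 1"
    using mub ij by (auto simp: mub_family_def orthonormal_basis_on_def)
  then show ?thesis
    by (simp add: ij mub_povm_def inner_on_def sum_divide_distrib[symmetric] mult.commute)
qed

text \<open>Tracing out the second copy in the 2-design identity gives this: the left side acquires
  the factor \<open>1 / (d + 1)\<close>, while \<open>I + SWAP\<close> becomes
  \<open>(d + 1) I\<close>.\<close>

lemma mub_povm_sum:
  assumes mub: "mub_family d \<beta>" and d: "d > 0" and X: "x \<in> {1..d}" "y \<in> {1..d}"
  shows "(\<Sum>k\<in>mub_outcomes d. mub_povm d \<beta> k x y) = of_bool (x = y)"
proof -
  have d0: "of_nat d + 1 \<noteq> (0 :: complex)"
    by (metis of_nat_Suc add.commute of_nat_neq_0)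
  have "(\<Sum>k\<in>mub_outcomes d. mub_povm d \<beta> k x y) / (of_nat d + 1) =
      (\<Sum>k\<in>mub_outcomes d. \<Sum>z\<in>{1..d}. mub_povm d \<beta> k x y * mub_povm d \<beta> k z z)"
    unfolding sum_divide_distrib sum_distrib_left[symmetric]
    by (rule sum.cong) (simp_all add: mub_povm_trace[OF mub] del: One_nat_def)
  also have "\<dots> = (\<Sum>z\<in>{1..d}. (of_bool (x = y) * of_bool (z = z) + of_bool (x = z) * of_bool (z = y)) / (of_nat d + 1)\<^sup>2)"
    by (subst sum.swap) (intro sum.cong refl mub_two_design[OF mub d] X; assumption)
  also have "\<dots> = (of_nat d * of_bool (x = y) + of_bool (x = y)) / (of_nat d + 1)\<^sup>2"
    using X unfolding sum_divide_distrib[symmetric] by (simp add: sum.distrib of_bool_def if_distrib[of "\<lambda>c. c * _"] cong: if_cong)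
  also have "\<dots> = of_bool (x = y) / (of_nat d + 1)"
    using d0 by (cases "x = y") (simp_all add: power2_eq_square)
  finally show ?thesis
    using d0 by simp
qed

section \<open>Principal minors of positive semidefinite operators\<close>

text \<open>The quadratic form at the vector \<open>A x y e_x - r e_y\<close> is a real quadratic
  polynomial in \<open>r\<close>; choosing \<open>r\<close> suitably gives the bound on the
  minor.\<close>

lemma psd_entry_bound:
  assumes psd: "psd_on B A" and B: "finite B" and x: "x \<in> B" and y: "y \<in> B"
  shows "(cmod (A x y))\<^sup>2 \<le> Re (A x x) * Re (A y y)"
proof -
  have cnj_delta: "cnj (if P then c else 0) = (if P then cnj c else 0)" for P c
    by simp
  have herm: "A y x = cnj (A x y)"
    using psd x y unfolding psd_on_def hermitian_on_def by blast
  let ?n = "(cmod (A x y))\<^sup>2"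
  have quad: "0 \<le> ?n * Re (A x x) - 2 * r * ?n + r\<^sup>2 * Re (A y y)" for r :: real
  proof -
    \<comment> \<open>Written as a difference of two deltas, the vector also covers the case
      \<open>x = y\<close>.\<close>
    let ?v = "\<lambda>z. (if z = x then A x y else 0) - (if z = y then of_real r else 0)"
    have lin: "(\<Sum>z\<in>B. f z * ?v z) = f x * A x y - f y * of_real r"
      "(\<Sum>z\<in>B. cnj (?v z) * f z) = cnj (A x y) * f x - of_real r * f y" for f
      using B x y
      by (simp_all add: left_diff_distrib right_diff_distrib sum_subtractf cnj_delta
          mult_delta_left mult_delta_right)
    have "inner_on B ?v (\<lambda>a. \<Sum>b\<in>B. A a b * ?v b) =
        cnj (A x y) * (A x x * A x y - A x y * of_real r)
        - of_real r * (A y x * A x y - A y y * of_real r)"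
      unfolding inner_on_def lin ..
    also have "\<dots> = of_real ?n * A x x - 2 * of_real r * of_real ?n + (of_real r)\<^sup>2 * A y y"
      unfolding herm complex_norm_square by (simp add: algebra_simps power2_eq_square)
    finally have eq: "inner_on B ?v (\<lambda>a. \<Sum>b\<in>B. A a b * ?v b) =
        of_real ?n * A x x - 2 * of_real r * of_real ?n + (of_real r)\<^sup>2 * A y y" .
    have "0 \<le> Re (inner_on B ?v (\<lambda>a. \<Sum>b\<in>B. A a b * ?v b))"
      using psd unfolding psd_on_def by blast
    then show ?thesis
      unfolding eq of_real_power[symmetric] by (simp del: of_real_power)
  qed
  have nonneg: "0 \<le> Re (A z z)" if "z \<in> B" for z
  proof -
    let ?v = "\<lambda>w. if w = z then 1 else 0 :: complex"
    have "inner_on B ?v (\<lambda>a. \<Sum>b\<in>B. A a b * ?v b) = A z z"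
      using B that by (simp add: inner_on_def cnj_delta mult_delta_left mult_delta_right)
    moreover have "0 \<le> Re (inner_on B ?v (\<lambda>a. \<Sum>b\<in>B. A a b * ?v b))"
      using psd unfolding psd_on_def by blast
    ultimately show ?thesis by simp
  qed
  show ?thesis
  proof (cases "Re (A x x) = 0")
    case True
    define b where "b = Re (A y y)"
    have b: "b \<ge> 0" using nonneg[OF y] by (simp add: b_def)
    \<comment> \<open>With \<open>A x x = 0\<close> the polynomial is \<open>r^2 b - 2 r n\<close>,
      negative for small \<open>r > 0\<close> unless \<open>n = 0\<close>. Dividing by
      \<open>b + 1\<close> stays safe when \<open>b = 0\<close>.\<close>
    define t where "t = ?n / (b + 1)"
    have n: "?n = t * (b + 1)" using b by (simp add: t_def)
    have "0 \<le> - (2 * t * ?n) + t\<^sup>2 * b"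
      using quad[of t] True by (simp add: b_def)
    also have "\<dots> = - (t\<^sup>2 * (b + 2))"
      unfolding n by (simp add: algebra_simps power2_eq_square)
    finally have "t\<^sup>2 * (b + 2) \<le> 0" by simp
    with b have "t = 0" by (simp add: mult_le_0_iff)
    then have "?n = 0" using n by simp
    then show ?thesis using True by simp
  next
    case False
    then have pos: "Re (A x x) > 0" using nonneg[OF x] by simp
    \<comment> \<open>At \<open>r = Re (A x x)\<close> the polynomial factors, and the positive
      factor can be cancelled.\<close>
    have "0 \<le> Re (A x x) * (Re (A x x) * Re (A y y) - ?n)"
      using quad[of "Re (A x x)"] by (simp add: algebra_simps power2_eq_square)
    then show ?thesis
      using pos by (simp add: zero_le_mult_iff)
  qed
qed

text \<open>
  The set \<open>I\<close> of parties is arbitrary so that the second moment formula below can be applied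
  to reduced states as well.
\<close>

definition reduced_op ::
    "(nat \<Rightarrow> nat) \<Rightarrow> nat set \<Rightarrow> nat set \<Rightarrow> (nat \<Rightarrow> nat) operator \<Rightarrow> (nat \<Rightarrow> nat) operator" where
  "reduced_op d I S A = (\<lambda>x y. \<Sum>z\<in>tensor_index d (I - S).
     A (merge S (I - S) (x, z)) (merge S (I - S) (y, z)))"

definition joint_dist ::
    "(nat \<Rightarrow> nat) \<Rightarrow> (nat \<Rightarrow> nat \<Rightarrow> nat \<Rightarrow> nat \<Rightarrow> complex) \<Rightarrow> nat set \<Rightarrow> (nat \<Rightarrow> nat) operator \<Rightarrow>
     (nat \<Rightarrow> nat \<times> nat) \<Rightarrow> real" where
  "joint_dist d \<beta> I A = (\<lambda>k.
     Re (op_trace (tensor_index d I)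
       (op_mult (tensor_index d I) (tensor_op I (\<lambda>i. mub_povm (d i) (\<beta> i) (k i))) A)))"

section \<open>Splitting multi-indices along a subset of the parties\<close>

lemma finite_tensor_index: "finite I \<Longrightarrow> finite (tensor_index d I)"
  by (simp add: tensor_index_def finite_PiE)

text \<open>Restriction to \<open>S\<close> and to \<open>I - S\<close> inverts \<open>merge\<close>
  because members of \<open>PiE\<close> are \<open>undefined\<close> outside their index
  set.\<close>

lemma sum_PiE_merge:
  assumes "S \<subseteq> I"
  shows "(\<Sum>x\<in>PiE I X. f x) = (\<Sum>a\<in>PiE S X. \<Sum>b\<in>PiE (I - S) X. f (merge S (I - S) (a, b)))"
  unfolding sum.cartesian_product
proof (rule sum.reindex_bij_witness[where j = "\<lambda>x. (restrict x S, restrict x (I - S))"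
      and i = "merge S (I - S)"])
  fix x assume x: "x \<in> PiE I X"
  show "merge S (I - S) (restrict x S, restrict x (I - S)) = x"
    using x assms by (auto simp: merge_def PiE_def extensional_def fun_eq_iff)
  show "(restrict x S, restrict x (I - S)) \<in> PiE S X \<times> PiE (I - S) X"
    using x assms by auto
next
  fix z assume z: "z \<in> PiE S X \<times> PiE (I - S) X"
  obtain a b where ab: "z = (a, b)" by (cases z)
  show "(restrict (merge S (I - S) z) S, restrict (merge S (I - S) z) (I - S)) = z"
    using z by (auto simp: ab PiE_def extensional_restrict)
  show "merge S (I - S) z \<in> PiE I X"
    using z assms PiE_cancel_merge[of S "I - S" a b X] by (auto simp: ab Un_absorb1)
qed (auto simp: merge_def PiE_def extensional_def split_def fun_eq_iff intro!: arg_cong[of _ _ f])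

lemma sum_tensor_index_merge:
  assumes "S \<subseteq> I"
  shows "(\<Sum>x\<in>tensor_index d I. f x) =
    (\<Sum>a\<in>tensor_index d S. \<Sum>b\<in>tensor_index d (I - S). f (merge S (I - S) (a, b)))"
  unfolding tensor_index_def using assms by (rule sum_PiE_merge)

lemma merge_in_tensor_index:
  assumes "S \<subseteq> I" "a \<in> tensor_index d S" "b \<in> tensor_index d (I - S)"
  shows "merge S (I - S) (a, b) \<in> tensor_index d I"
  using assms PiE_cancel_merge[of S "I - S" a b "\<lambda>i. {1..d i}"]
  unfolding tensor_index_def by (auto simp: Un_absorb1 PiE_def)

text \<open>Two multi-indices that differ must differ inside \<open>S\<close>, since both are
  \<open>undefined\<close> elsewhere.\<close>

lemma prod_of_bool_eq:
  assumes "finite S" "a \<in> tensor_index d S" "b \<in> tensor_index d S"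
  shows "(\<Prod>i\<in>S. of_bool (a i = b i)) = (of_bool (a = b) :: complex)"
proof (cases "a = b")
  case False
  then obtain i where "a i \<noteq> b i" by auto
  moreover from this have "i \<in> S"
    using assms unfolding tensor_index_def by (metis PiE_arb)
  ultimately show ?thesis
    using assms(1) False by (auto intro!: prod_zero)
qed simp

section \<open>Hilbert-Schmidt norm and purity\<close>

lemma op_trace_square:
  "op_trace B (op_mult B A A) = (\<Sum>x\<in>B. \<Sum>y\<in>B. A x y * A y x)"
  by (simp add: op_trace_def op_mult_def)

lemma op_trace_square_hermitian:
  assumes "hermitian_on B A"
  shows "op_trace B (op_mult B A A) = of_real (\<Sum>x\<in>B. \<Sum>y\<in>B. (cmod (A x y))\<^sup>2)"
proof -
  have "op_trace B (op_mult B A A) = (\<Sum>x\<in>B. \<Sum>y\<in>B. of_real ((cmod (A x y))\<^sup>2))"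
    unfolding op_trace_square complex_norm_square
    using assms unfolding hermitian_on_def by (intro sum.cong refl arg_cong2[of _ _ _ _ "(*)"]) blast
  then show ?thesis by simp
qed

lemma op_norm2_square:
  assumes "hermitian_on B A"
  shows "(op_norm2 B A)\<^sup>2 = Re (op_trace B (op_mult B A A))"
  unfolding op_norm2_def op_trace_square_hermitian[OF assms] Re_complex_of_real
  by (intro real_sqrt_pow2 sum_nonneg) auto

text \<open>Bounding each \<open>|A x y|^2\<close> by the product of two diagonal entries turns the
  double sum into \<open>(Tr A)^2\<close>, so no eigenvalues enter.\<close>

lemma density_purity_le_1:
  assumes "density_operator B A" "finite B"
  shows "Re (op_trace B (op_mult B A A)) \<le> 1"
proof -
  have psd: "psd_on B A" and tr: "op_trace B A = 1"
    using assms by (auto simp: density_operator_def)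
  have "Re (op_trace B (op_mult B A A)) = (\<Sum>x\<in>B. \<Sum>y\<in>B. (cmod (A x y))\<^sup>2)"
    using psd by (subst op_trace_square_hermitian) (auto simp: psd_on_def)
  also have "\<dots> \<le> (\<Sum>x\<in>B. \<Sum>y\<in>B. Re (A x x) * Re (A y y))"
    using psd assms(2) by (intro sum_mono psd_entry_bound)
  also have "\<dots> = (Re (op_trace B A))\<^sup>2"
    by (simp add: op_trace_def power2_eq_square sum_product)
  finally show ?thesis by (simp add: tr)
qed

section \<open>Reduced operators\<close>

lemma hermitian_reduced_op:
  assumes "hermitian_on (tensor_index d I) A" "S \<subseteq> I"
  shows "hermitian_on (tensor_index d S) (reduced_op d I S A)"
  unfolding hermitian_on_def
proof (intro ballI)
  fix x y assume "x \<in> tensor_index d S" "y \<in> tensor_index d S"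
  then show "reduced_op d I S A x y = cnj (reduced_op d I S A y x)"
    using assms merge_in_tensor_index[OF assms(2)]
    unfolding reduced_op_def hermitian_on_def cnj_sum by (intro sum.cong refl) blast
qed

text \<open>The quadratic form of the reduced operator at \<open>v\<close> is the sum, over basis
  vectors \<open>z\<close> of the traced out space, of the form of \<open>A\<close> at
  \<open>v \<otimes> z\<close>; each summand is nonnegative.\<close>

lemma density_reduced_op:
  assumes A: "density_operator (tensor_index d I) A" and S: "S \<subseteq> I" and I: "finite I"
  shows "density_operator (tensor_index d S) (reduced_op d I S A)"
  unfolding density_operator_def psd_on_def
proof (intro conjI allI)
  let ?B = "tensor_index d S" and ?C = "tensor_index d (I - S)" and ?T = "tensor_index d I"
  let ?m = "\<lambda>a z. merge S (I - S) (a, z)"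
  have psd: "psd_on ?T A" and tr: "op_trace ?T A = 1"
    using A by (auto simp: density_operator_def)
  have fin: "finite ?B" "finite ?C"
    using I S finite_subset by (auto intro!: finite_tensor_index)
  show "hermitian_on ?B (reduced_op d I S A)"
    using psd S by (auto simp: psd_on_def intro: hermitian_reduced_op)
  show "op_trace ?B (reduced_op d I S A) = 1"
    using tr unfolding op_trace_def reduced_op_def sum_tensor_index_merge[OF S] .
  fix v :: "(nat \<Rightarrow> nat) \<Rightarrow> complex"
  \<comment> \<open>\<open>w z\<close> is the tensor product of \<open>v\<close> with the basis vector \<open>z\<close> of the traced out space\<close>
  define w where "w z x = (if restrict x (I - S) = z then v (restrict x S) else 0)" for z x :: "nat \<Rightarrow> nat"
  have w: "w z (?m a b) = (if b = z then v a else 0)"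
    if "a \<in> ?B" "b \<in> ?C" for a b z
    using that by (auto simp: w_def tensor_index_def PiE_def extensional_restrict)
  have "inner_on ?T (w z) (\<lambda>x. \<Sum>y\<in>?T. A x y * w z y) =
      (\<Sum>a\<in>?B. \<Sum>c\<in>?B. cnj (v a) * (A (?m a z) (?m c z) * v c))" if z: "z \<in> ?C" for z
  proof -
    have "(\<Sum>y\<in>?T. A x y * w z y) = (\<Sum>c\<in>?B. A x (?m c z) * v c)" for x
      unfolding sum_tensor_index_merge[OF S] using fin z
      by (intro sum.cong refl) (simp add: w mult_delta_right)
    then have "inner_on ?T (w z) (\<lambda>x. \<Sum>y\<in>?T. A x y * w z y) =
        (\<Sum>a\<in>?B. \<Sum>b\<in>?C. cnj (w z (?m a b)) * (\<Sum>c\<in>?B. A (?m a b) (?m c z) * v c))"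
      unfolding inner_on_def sum_tensor_index_merge[OF S] by simp
    also have "\<dots> = (\<Sum>a\<in>?B. \<Sum>b\<in>?C. (if b = z then cnj (v a) * (\<Sum>c\<in>?B. A (?m a b) (?m c z) * v c) else 0))"
      by (intro sum.cong refl) (simp add: w)
    finally show ?thesis
      using fin z by (simp add: sum_distrib_left)
  qed
  then have "(\<Sum>z\<in>?C. inner_on ?T (w z) (\<lambda>x. \<Sum>y\<in>?T. A x y * w z y)) =
      (\<Sum>z\<in>?C. \<Sum>a\<in>?B. \<Sum>c\<in>?B. cnj (v a) * (A (?m a z) (?m c z) * v c))"
    by simp
  also have "\<dots> = (\<Sum>a\<in>?B. \<Sum>c\<in>?B. \<Sum>z\<in>?C. cnj (v a) * (A (?m a z) (?m c z) * v c))"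
    by (subst sum.swap) (intro sum.cong refl sum.swap)
  also have "\<dots> = inner_on ?B v (\<lambda>x. \<Sum>y\<in>?B. reduced_op d I S A x y * v y)"
    unfolding inner_on_def reduced_op_def sum_distrib_left sum_distrib_right ..
  finally have "Re (inner_on ?B v (\<lambda>x. \<Sum>y\<in>?B. reduced_op d I S A x y * v y)) =
      (\<Sum>z\<in>?C. Re (inner_on ?T (w z) (\<lambda>x. \<Sum>y\<in>?T. A x y * w z y)))"
    by (metis Re_sum)
  also have "\<dots> \<ge> 0"
    using psd unfolding psd_on_def by (intro sum_nonneg) blast
  finally show "0 \<le> Re (inner_on ?B v (\<lambda>x. \<Sum>y\<in>?B. reduced_op d I S A x y * v y))" .
qed

section \<open>Outcome distributions: second moments and marginals\<close>

text \<open>Conjugation transposes both Hermitian factors, which only swaps the two summation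
  indices, so the trace is real. This removes \<open>Re\<close> and lets later sums be rearranged
  over the complex numbers.\<close>

lemma joint_dist_complex:
  assumes "hermitian_on (tensor_index d I) A"
  shows "of_real (joint_dist d \<beta> I A k) =
    (\<Sum>x\<in>tensor_index d I. \<Sum>y\<in>tensor_index d I.
       (\<Prod>i\<in>I. mub_povm (d i) (\<beta> i) (k i) (x i) (y i)) * A y x)" (is "_ = ?t")
proof -
  have povm: "cnj (mub_povm n b l s t) = mub_povm n b l t s" for n b l s t
    by (simp add: mub_povm_def split_def mult.commute)
  have "cnj ?t = (\<Sum>x\<in>tensor_index d I. \<Sum>y\<in>tensor_index d I.
       (\<Prod>i\<in>I. mub_povm (d i) (\<beta> i) (k i) (y i) (x i)) * cnj (A y x))"
    by (simp add: povm)
  also have "\<dots> = (\<Sum>x\<in>tensor_index d I. \<Sum>y\<in>tensor_index d I.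
       (\<Prod>i\<in>I. mub_povm (d i) (\<beta> i) (k i) (y i) (x i)) * A x y)"
    using assms unfolding hermitian_on_def
    by (intro sum.cong refl arg_cong2[of _ _ _ _ "(*)"]) (metis)
  also have "\<dots> = ?t"
    by (rule sum.swap)
  finally have "?t \<in> \<real>"
    unfolding Reals_cnj_iff .
  then have "of_real (Re ?t) = ?t"
    by (rule of_real_Re)
  then show ?thesis
    by (simp only: joint_dist_def op_trace_def op_mult_def tensor_op_def)
qed

text \<open>Stated for Hermitian \<open>A\<close>, not only for states, so that it covers a
  difference of two states.\<close>

lemma joint_dist_square_sum:
  assumes I: "finite I" and mub: "\<And>i. i \<in> I \<Longrightarrow> mub_family (d i) (\<beta> i)"
    and d: "\<And>i. i \<in> I \<Longrightarrow> d i > 0"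
    and A: "hermitian_on (tensor_index d I) A"
  shows "(\<Sum>k\<in>joint_outcomes d I. (joint_dist d \<beta> I A k)\<^sup>2) =
    (\<Sum>S\<in>Pow I. Re (op_trace (tensor_index d S)
        (op_mult (tensor_index d S) (reduced_op d I S A) (reduced_op d I S A))))
      / (\<Prod>i\<in>I. real (d i) + 1)\<^sup>2"
proof -
  let ?T = "tensor_index d I"
  define P where "P k x y = (\<Prod>i\<in>I. mub_povm (d i) (\<beta> i) (k i) (x i) (y i))" for k x y
  define N :: complex where "N = (\<Prod>i\<in>I. of_nat (d i) + 1)"
  \<comment> \<open>The entries of the operator on two copies that swaps the parties in
    \<open>S\<close> and is the identity on the others.\<close>
  define D where "D S x y x' y' = (\<Prod>i\<in>S. of_bool (x i = y' i) * of_bool (x' i = y i)) *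
     (\<Prod>i\<in>I - S. of_bool (x i = y i) * of_bool (x' i = y' i) :: complex)"
    for S and x y x' y' :: "nat \<Rightarrow> nat"
  have N2: "N\<^sup>2 = (\<Prod>i\<in>I. (of_nat (d i) + 1)\<^sup>2)"
    by (simp add: N_def prod_power_distrib)
  have PP: "(\<Sum>k\<in>joint_outcomes d I. P k x y * P k x' y') = (\<Sum>S\<in>Pow I. D S x y x' y') / N\<^sup>2"
    if "x \<in> ?T" "y \<in> ?T" "x' \<in> ?T" "y' \<in> ?T" for x y x' y'
  proof -
    have "(\<Sum>k\<in>joint_outcomes d I. P k x y * P k x' y') =
       (\<Prod>i\<in>I. \<Sum>k\<in>mub_outcomes (d i). mub_povm (d i) (\<beta> i) k (x i) (y i) *
          mub_povm (d i) (\<beta> i) k (x' i) (y' i))"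
      unfolding P_def prod.distrib[symmetric] joint_outcomes_def
      using I by (subst prod_sum_PiE) (auto simp: mub_outcomes_def)
    \<comment> \<open>The swap term is put first because \<open>prod_add\<close> takes first
      summands on \<open>S\<close> and second ones on \<open>I - S\<close>.\<close>
    also have "\<dots> = (\<Prod>i\<in>I. (of_bool (x i = y' i) * of_bool (x' i = y i) +
        of_bool (x i = y i) * of_bool (x' i = y' i)) / (of_nat (d i) + 1)\<^sup>2)"
    proof (rule prod.cong[OF refl])
      fix i assume i: "i \<in> I"
      then have "x i \<in> {1..d i}" "y i \<in> {1..d i}" "x' i \<in> {1..d i}" "y' i \<in> {1..d i}"
        using that unfolding tensor_index_def by blast+
      from mub_two_design[OF mub[OF i] d[OF i] this]
      show "(\<Sum>k\<in>mub_outcomes (d i). mub_povm (d i) (\<beta> i) k (x i) (y i) *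
          mub_povm (d i) (\<beta> i) k (x' i) (y' i)) = (of_bool (x i = y' i) * of_bool (x' i = y i) +
        of_bool (x i = y i) * of_bool (x' i = y' i)) / (of_nat (d i) + 1)\<^sup>2"
        by (simp only: add.commute)
    qed
    also have "\<dots> = (\<Sum>S\<in>Pow I. D S x y x' y') / N\<^sup>2"
      unfolding prod_dividef prod_add[OF I] D_def N2 ..
    finally show ?thesis .
  qed
  \<comment> \<open>The identity on \<open>I - S\<close> traces those parties out in each copy
    separately (\<open>e = b\<close>, \<open>e' = b'\<close>). The swap on \<open>S\<close> chains
    the two copies into a matrix product (\<open>a' = c\<close>, \<open>c' = a\<close>).\<close>
  have DA: "(\<Sum>x\<in>?T. \<Sum>y\<in>?T. \<Sum>x'\<in>?T. \<Sum>y'\<in>?T. D S x y x' y' * (A y x * A y' x')) =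
      op_trace (tensor_index d S)
        (op_mult (tensor_index d S) (reduced_op d I S A) (reduced_op d I S A))"
    if S: "S \<subseteq> I" for S
  proof -
    let ?B = "tensor_index d S" and ?C = "tensor_index d (I - S)"
    let ?m = "\<lambda>a z. merge S (I - S) (a, z)"
    have fin: "finite S" "finite (I - S)" "finite ?B" "finite ?C"
      using I S finite_subset by (auto intro!: finite_tensor_index)
    have of_bool_mult: "of_bool P * c = (if P then c else 0)" for P and c :: complex
      by simp
    have D: "D S (?m a b) (?m c e) (?m a' b') (?m c' e') =
        of_bool (b = e) * (of_bool (c = a') * (of_bool (b' = e') * of_bool (a = c')))"
      if "a \<in> ?B" "b \<in> ?C" "c \<in> ?B" "e \<in> ?C" "a' \<in> ?B" "b' \<in> ?C" "c' \<in> ?B" "e' \<in> ?C"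
      for a b c e a' b' c' e'
      unfolding D_def using that fin
      by (simp add: prod.distrib prod_of_bool_eq mult_ac eq_commute[of a' c])
    have "(\<Sum>x\<in>?T. \<Sum>y\<in>?T. \<Sum>x'\<in>?T. \<Sum>y'\<in>?T. D S x y x' y' * (A y x * A y' x')) =
      (\<Sum>a\<in>?B. \<Sum>b\<in>?C. \<Sum>c\<in>?B. \<Sum>e\<in>?C. \<Sum>a'\<in>?B. \<Sum>b'\<in>?C. \<Sum>c'\<in>?B. \<Sum>e'\<in>?C.
        of_bool (b = e) * (of_bool (c = a') * (of_bool (b' = e') * (of_bool (a = c') *
          (A (?m c e) (?m a b) * A (?m c' e') (?m a' b'))))))"
      unfolding sum_tensor_index_merge[OF S]
      by (intro sum.cong refl) (simp add: D)
    also have "\<dots> = (\<Sum>a\<in>?B. \<Sum>b\<in>?C. \<Sum>c\<in>?B. \<Sum>b'\<in>?C. A (?m c b) (?m a b) * A (?m a b') (?m c b'))"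
      unfolding sum_distrib_left[symmetric] using fin
      by (simp add: of_bool_mult) (simp add: sum_distrib_left)
    also have "\<dots> = (\<Sum>a\<in>?B. \<Sum>c\<in>?B. \<Sum>b\<in>?C. \<Sum>b'\<in>?C. A (?m c b) (?m a b) * A (?m a b') (?m c b'))"
      by (intro sum.cong refl sum.swap)
    also have "\<dots> = (\<Sum>a\<in>?B. \<Sum>c\<in>?B. reduced_op d I S A c a * reduced_op d I S A a c)"
      unfolding reduced_op_def sum_product ..
    also have "\<dots> = op_trace ?B (op_mult ?B (reduced_op d I S A) (reduced_op d I S A))"
      unfolding op_trace_square by (rule sum.swap)
    finally show ?thesis .
  qed
  have "of_real (\<Sum>k\<in>joint_outcomes d I. (joint_dist d \<beta> I A k)\<^sup>2) =
      (\<Sum>k\<in>joint_outcomes d I. (\<Sum>x\<in>?T. \<Sum>y\<in>?T. P k x y * A y x)\<^sup>2)"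
    by (simp add: joint_dist_complex[OF A] P_def)
  also have "\<dots> = (\<Sum>k\<in>joint_outcomes d I. \<Sum>x\<in>?T. \<Sum>y\<in>?T. \<Sum>x'\<in>?T. \<Sum>y'\<in>?T.
      P k x y * P k x' y' * (A y x * A y' x'))"
    unfolding power2_eq_square sum_distrib_left sum_distrib_right
    by (intro sum.cong refl) (simp add: mult_ac)
  also have "\<dots> = (\<Sum>x\<in>?T. \<Sum>y\<in>?T. \<Sum>x'\<in>?T. \<Sum>y'\<in>?T.
      (\<Sum>k\<in>joint_outcomes d I. P k x y * P k x' y') * (A y x * A y' x'))"
    \<comment> \<open>Fixing one index set orients \<open>sum.swap\<close>: here the sum over
      outcomes moves inward past the other four, below the sum over \<open>Pow I\<close> moves
      outward.\<close>
    unfolding sum_distrib_right by (simp only: sum.swap[of _ _ "joint_outcomes d I"])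
  also have "\<dots> = (\<Sum>x\<in>?T. \<Sum>y\<in>?T. \<Sum>x'\<in>?T. \<Sum>y'\<in>?T.
      (\<Sum>S\<in>Pow I. D S x y x' y' * (A y x * A y' x') / N\<^sup>2))"
    by (intro sum.cong refl) (simp add: PP sum_distrib_right sum_divide_distrib)
  also have "\<dots> = (\<Sum>S\<in>Pow I. \<Sum>x\<in>?T. \<Sum>y\<in>?T. \<Sum>x'\<in>?T. \<Sum>y'\<in>?T.
      D S x y x' y' * (A y x * A y' x') / N\<^sup>2)"
    by (simp only: sum.swap[of _ "Pow I"])
  also have "\<dots> = (\<Sum>S\<in>Pow I. op_trace (tensor_index d S)
        (op_mult (tensor_index d S) (reduced_op d I S A) (reduced_op d I S A))) / N\<^sup>2"
    unfolding sum_divide_distrib[symmetric] by (simp add: DA)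
  also have "N\<^sup>2 = of_real ((\<Prod>i\<in>I. real (d i) + 1)\<^sup>2)"
    by (simp add: N_def)
  finally have "(\<Sum>k\<in>joint_outcomes d I. (joint_dist d \<beta> I A k)\<^sup>2) =
      Re ((\<Sum>S\<in>Pow I. op_trace (tensor_index d S)
        (op_mult (tensor_index d S) (reduced_op d I S A) (reduced_op d I S A))) /
        of_real ((\<Prod>i\<in>I. real (d i) + 1)\<^sup>2))"
    by (metis Re_complex_of_real)
  then show ?thesis
    by (simp only: Re_divide_of_real Re_sum)
qed

text \<open>Summing the POVM elements over the outcomes outside \<open>S\<close> leaves the identity
  there, and pairing it with \<open>A\<close> is the partial trace. As \<open>k\<close> is
  arbitrary, this gives an equality of functions.\<close>

lemma joint_dist_marginal:
  assumes I: "finite I" and mub: "\<And>i. i \<in> I \<Longrightarrow> mub_family (d i) (\<beta> i)"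
    and d: "\<And>i. i \<in> I \<Longrightarrow> d i > 0"
    and A: "hermitian_on (tensor_index d I) A" and S: "S \<subseteq> I"
  shows "(\<Sum>l\<in>joint_outcomes d (I - S). joint_dist d \<beta> I A (merge S (I - S) (k, l))) =
    joint_dist d \<beta> S (reduced_op d I S A) k"
proof -
  let ?B = "tensor_index d S" and ?C = "tensor_index d (I - S)" and ?T = "tensor_index d I"
  let ?m = "\<lambda>a z. merge S (I - S) (a, z)"
  let ?P = "\<lambda>i. mub_povm (d i) (\<beta> i)"
  have fin: "finite S" "finite (I - S)" "finite ?B" "finite ?C"
    using I S finite_subset by (auto intro!: finite_tensor_index)
  have complete: "(\<Sum>l\<in>joint_outcomes d (I - S). \<Prod>i\<in>I. ?P i (?m k l i) (?m a b i) (?m c e i)) =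
      of_bool (b = e) * (\<Prod>i\<in>S. ?P i (k i) (a i) (c i))"
    if "a \<in> ?B" "b \<in> ?C" "c \<in> ?B" "e \<in> ?C" for a b c e
  proof -
    have "(\<Prod>i\<in>I. ?P i (?m k l i) (?m a b i) (?m c e i)) =
        (\<Prod>i\<in>I - S. ?P i (l i) (b i) (e i)) * (\<Prod>i\<in>S. ?P i (k i) (a i) (c i))" for l
      using I S by (simp add: prod.subset_diff)
    then have "(\<Sum>l\<in>joint_outcomes d (I - S). \<Prod>i\<in>I. ?P i (?m k l i) (?m a b i) (?m c e i)) =
        (\<Prod>i\<in>I - S. \<Sum>l\<in>mub_outcomes (d i). ?P i l (b i) (e i)) * (\<Prod>i\<in>S. ?P i (k i) (a i) (c i))"
      unfolding joint_outcomes_def using I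
      by (subst prod_sum_PiE) (auto simp: mub_outcomes_def sum_distrib_right)
    also have "(\<Prod>i\<in>I - S. \<Sum>l\<in>mub_outcomes (d i). ?P i l (b i) (e i)) =
        (\<Prod>i\<in>I - S. of_bool (b i = e i))"
    proof (intro prod.cong refl mub_povm_sum mub d)
      fix i assume "i \<in> I - S"
      then show "b i \<in> {1..d i}" "e i \<in> {1..d i}"
        using that unfolding tensor_index_def by blast+
    qed auto
    also have "\<dots> = of_bool (b = e)"
      using that fin by (intro prod_of_bool_eq)
    finally show ?thesis .
  qed
  have "complex_of_real (\<Sum>l\<in>joint_outcomes d (I - S). joint_dist d \<beta> I A (?m k l)) =
      (\<Sum>l\<in>joint_outcomes d (I - S). \<Sum>x\<in>?T. \<Sum>y\<in>?T. (\<Prod>i\<in>I. ?P i (?m k l i) (x i) (y i)) * A y x)"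
    by (simp add: joint_dist_complex[OF A])
  also have "\<dots> = (\<Sum>x\<in>?T. \<Sum>y\<in>?T. (\<Sum>l\<in>joint_outcomes d (I - S). \<Prod>i\<in>I. ?P i (?m k l i) (x i) (y i)) * A y x)"
    unfolding sum_distrib_right by (simp only: sum.swap[of _ _ "joint_outcomes d (I - S)"])
  also have "\<dots> = (\<Sum>a\<in>?B. \<Sum>b\<in>?C. \<Sum>c\<in>?B. \<Sum>e\<in>?C.
      of_bool (b = e) * ((\<Prod>i\<in>S. ?P i (k i) (a i) (c i)) * A (?m c e) (?m a b)))"
    unfolding sum_tensor_index_merge[OF S] by (intro sum.cong refl) (simp add: complete del: merge_apply)
  also have "\<dots> = (\<Sum>a\<in>?B. \<Sum>b\<in>?C. \<Sum>c\<in>?B.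
      (\<Prod>i\<in>S. ?P i (k i) (a i) (c i)) * A (?m c b) (?m a b))"
    using fin by (simp add: of_bool_def mult_delta_left)
  also have "\<dots> = (\<Sum>a\<in>?B. \<Sum>c\<in>?B. \<Sum>b\<in>?C.
      (\<Prod>i\<in>S. ?P i (k i) (a i) (c i)) * A (?m c b) (?m a b))"
    by (intro sum.cong refl sum.swap)
  also have "\<dots> = of_real (joint_dist d \<beta> S (reduced_op d I S A) k)"
    unfolding joint_dist_complex[OF hermitian_reduced_op[OF A S]]
    by (simp add: reduced_op_def sum_distrib_left)
  finally show ?thesis
    unfolding of_real_eq_iff .
qed

text \<open>Every reduction of a state is a state, so each of the \<open>2^|I|\<close> purities in
  the second moment is at most 1; the square root halves the exponent.\<close>

lemma joint_dist_norm_le: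
  assumes I: "finite I" and mub: "\<And>i. i \<in> I \<Longrightarrow> mub_family (d i) (\<beta> i)"
    and d: "\<And>i. i \<in> I \<Longrightarrow> d i > 0"
    and A: "density_operator (tensor_index d I) A"
  shows "L2_set (joint_dist d \<beta> I A) (joint_outcomes d I) \<le>
    2 powr (real (card I) / 2) / (\<Prod>i\<in>I. real (d i) + 1)"
proof -
  let ?N = "\<Prod>i\<in>I. real (d i) + 1"
  have "?N > 0" by (intro prod_pos) (simp add: add_nonneg_pos)
  have herm: "hermitian_on (tensor_index d I) A"
    using A by (simp add: density_operator_def psd_on_def)
  have "(\<Sum>k\<in>joint_outcomes d I. (joint_dist d \<beta> I A k)\<^sup>2) \<le> (\<Sum>S\<in>Pow I. 1) / ?N\<^sup>2"
    unfolding joint_dist_square_sum[OF I mub d herm, simplified]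
    using I by (intro divide_right_mono sum_mono density_purity_le_1 density_reduced_op A finite_tensor_index)
      (auto intro: finite_subset)
  also have "\<dots> = 2 powr real (card I) / ?N\<^sup>2"
    using I by (simp add: card_Pow powr_realpow)
  finally have "L2_set (joint_dist d \<beta> I A) (joint_outcomes d I) \<le> sqrt (2 powr real (card I) / ?N\<^sup>2)"
    unfolding L2_set_def by (rule real_sqrt_le_mono)
  also have "\<dots> = 2 powr (real (card I) / 2) / ?N"
    using \<open>?N > 0\<close> by (simp add: real_sqrt_divide powr_half_sqrt[symmetric] powr_powr)
  finally show ?thesis .
qed

section \<open>Distance of two outcome distributions and size of their marginals\<close>

theorem theorem1p2p2:
  fixes m :: nat
    and d :: "nat \<Rightarrow> nat"
    and \<beta> :: "nat \<Rightarrow> nat \<Rightarrow> nat \<Rightarrow> nat \<Rightarrow> complex"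
    and \<rho> \<sigma> :: "(nat \<Rightarrow> nat) operator"
    and p q :: "(nat \<Rightarrow> nat \<times> nat) \<Rightarrow> real"
  assumes "m \<ge> 1"
    and "\<forall>i\<in>{1..m}. \<exists>k. d i = 2 ^ k"
    and "\<forall>i\<in>{1..m}. mub_family (d i) (\<beta> i)"
    and "density_operator (tensor_index d {1..m}) \<rho>"
    and "density_operator (tensor_index d {1..m}) \<sigma>"
    and "p = outcome_dist m d \<beta> \<rho>"
    and "q = outcome_dist m d \<beta> \<sigma>"
  shows "L2_set (\<lambda>k. p k - q k) (joint_outcomes d {1..m}) =
           sqrt (\<Sum>S\<in>Pow {1..m}. (op_norm2 (tensor_index d S)
             (op_diff (partial_trace m d S \<rho>) (partial_trace m d S \<sigma>)))\<^sup>2)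
           / (\<Prod>i\<in>{1..m}. real (d i) + 1)
       \<and> (\<forall>S\<subseteq>{1..m}.
             L2_set (marginal m d S p) (joint_outcomes d S)
               \<le> 2 powr (real (card S) / 2) / (\<Prod>i\<in>S. real (d i) + 1)
           \<and> L2_set (marginal m d S q) (joint_outcomes d S)
               \<le> 2 powr (real (card S) / 2) / (\<Prod>i\<in>S. real (d i) + 1))"
proof -
  let ?I = "{1..m}" and ?D = "op_diff \<rho> \<sigma>"
  let ?N = "\<Prod>i\<in>{1..m}. real (d i) + 1"
  have mub: "mub_family (d i) (\<beta> i)" if "i \<in> ?I" for i
    using assms(3) that by blast
  have d: "d i > 0" if "i \<in> ?I" for i
    using assms(2) that by (metis zero_less_numeral zero_less_power)
  have dist: "outcome_dist m d \<beta> A = joint_dist d \<beta> ?I A" for A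
    by (simp add: outcome_dist_def joint_dist_def)
  have red: "partial_trace m d S A = reduced_op d ?I S A" for S A
    by (simp add: partial_trace_def reduced_op_def)
  \<comment> \<open>The marginal on \<open>S\<close> is the outcome distribution of the reduced
    state, so the norm bound applies with \<open>S\<close> as the set of parties.\<close>
  have bound: "L2_set (marginal m d S (outcome_dist m d \<beta> A)) (joint_outcomes d S)
      \<le> 2 powr (real (card S) / 2) / (\<Prod>i\<in>S. real (d i) + 1)"
    if A: "density_operator (tensor_index d ?I) A" and S: "S \<subseteq> ?I" for A S
  proof -
    have "marginal m d S (outcome_dist m d \<beta> A) = joint_dist d \<beta> S (reduced_op d ?I S A)"
      unfolding marginal_def dist
      using A by (intro ext joint_dist_marginal mub d S) (auto simp: density_operator_def psd_on_def)
    then show ?thesis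
      using S finite_subset[OF S] mub d density_reduced_op[OF A S]
      by (auto intro!: joint_dist_norm_le)
  qed
  have herm: "hermitian_on (tensor_index d ?I) ?D"
    using assms(4,5) unfolding density_operator_def psd_on_def hermitian_on_def op_diff_def
    by (metis complex_cnj_diff)
  \<comment> \<open>Outcome probabilities and, in \<open>red_diff\<close>, partial traces are
    linear, so both sides of the equality concern the single operator
    \<open>\<rho> - \<sigma>\<close>.\<close>
  have diff: "p k - q k = joint_dist d \<beta> ?I ?D k" for k
    unfolding assms(6,7) dist joint_dist_def op_trace_def op_mult_def op_diff_def
    by (simp add: right_diff_distrib sum_subtractf)
  have red_diff: "op_diff (partial_trace m d S \<rho>) (partial_trace m d S \<sigma>) = reduced_op d ?I S ?D" for S
    by (simp add: red reduced_op_def op_diff_def sum_subtractf)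
  have "(\<Sum>k\<in>joint_outcomes d ?I. (joint_dist d \<beta> ?I ?D k)\<^sup>2) =
      (\<Sum>S\<in>Pow ?I. Re (op_trace (tensor_index d S)
        (op_mult (tensor_index d S) (reduced_op d ?I S ?D) (reduced_op d ?I S ?D)))) / ?N\<^sup>2"
    by (intro joint_dist_square_sum finite_atLeastAtMost mub d herm)
  \<comment> \<open>Squaring \<open>op_norm2\<close> undoes its root because the trace of the square
    of a Hermitian operator is nonnegative.\<close>
  also have "\<dots> = (\<Sum>S\<in>Pow ?I. (op_norm2 (tensor_index d S) (reduced_op d ?I S ?D))\<^sup>2) / ?N\<^sup>2"
    using herm by (simp add: op_norm2_square hermitian_reduced_op)
  finally have "L2_set (\<lambda>k. p k - q k) (joint_outcomes d ?I) =
      sqrt ((\<Sum>S\<in>Pow ?I. (op_norm2 (tensor_index d S) (reduced_op d ?I S ?D))\<^sup>2) / ?N\<^sup>2)"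
    by (simp only: L2_set_def diff)
  also have "\<dots> = sqrt (\<Sum>S\<in>Pow ?I. (op_norm2 (tensor_index d S) (reduced_op d ?I S ?D))\<^sup>2) / ?N"
    by (simp add: real_sqrt_divide abs_of_nonneg prod_nonneg)
  finally show ?thesis
    using bound assms(4-7) unfolding red_diff by blast
qed

end
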